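(* Let $0<\varphi\le\frac{\pi}{2}$, $c=\cos\varphi$, $s=\sin\varphi=\sqrt{1-c^2}$. The optimal inner quartic $G^1$ approximant of the circular arc $\alpha\mapsto(\cos\alpha,\sin\alpha)^T$, $\alpha\in[-\varphi,\varphi]$, is given by the parameters $$\xi^\lor=\frac{c(1-c^2)+(1-c)^2\sqrt{3+4c+c^2}}{2\sqrt{1-c^2}},\qquad \eta^\lor=\frac13\left(8-7c+2c^3-2(1-c)^2\sqrt{3+4c+c^2}\right),$$ which coincide with the parameters of the optimal inner quartic $G^2$ approximant.
   Context: For real $\xi>0$ and $\eta\in\mathbb{R}$, the quartic $G^1$ approximant with parameters $(\xi,\eta)$ is the curve $p:[-1,1]\to\mathbb{R}^2$, $p(t)=\sum_{i=0}^4\binom{4}{i}\left(\frac{1+t}{2}\right)^i\left(\frac{1-t}{2}\right)^{4-i}b_i$, with control points $b_0=(c,-s)^T$, $b_1=(c,-s)^T+\xi(s,c)^T$, $b_2=(\eta,0)^T$, $b_3=(c,s)^T+\xi(s,-c)^T$, $b_4=(c,s)^T$. Its simplified radial error function is $\psi(t,\xi,\eta)=\|p(t)\|_2^2-1$. The approximant is inner if $\psi(t,\xi,\eta)\le0$ for all $t\in[-1,1]$. It is a $G^2$ approximant if it additionally interpolates the signed curvature of the arc at the two boundary points, equivalently $4\xi^2+3c\eta=3$. An inner $G^1$ (respectively $G^2$) approximant is optimal if it minimizes $\max_{t\in[-1,1]}|\psi(t,\xi,\eta)|$ among all inner $G^1$ (respectively $G^2$) approximants of this form (with $\xi>0$,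 $\eta\in\mathbb{R}$). *)

theory Defs
  imports "HOL-Analysis.Analysis"
begin

definition bezier4 :: "(nat \<Rightarrow> real ^ 2) \<Rightarrow> real \<Rightarrow> real ^ 2" where
  "bezier4 b t = (\<Sum>i\<le>4. (real (4 choose i) * ((1 + t) / 2) ^ i * ((1 - t) / 2) ^ (4 - i)) *\<^sub>R b i)"

definition control_point :: "real \<Rightarrow> real \<Rightarrow> real \<Rightarrow> nat \<Rightarrow> real ^ 2" where
  "control_point \<phi> \<xi> \<eta> i =
    [vector [cos \<phi>, - sin \<phi>],
     vector [cos \<phi>, - sin \<phi>] + \<xi> *\<^sub>R vector [sin \<phi>, cos \<phi>],
     vector [\<eta>, 0],
     vector [cos \<phi>, sin \<phi>] + \<xi> *\<^sub>R vector [sin \<phi>, - cos \<phi>],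
     vector [cos \<phi>, sin \<phi>]] ! i"

definition G1_approximant :: "real \<Rightarrow> real \<Rightarrow> real \<Rightarrow> real \<Rightarrow> real ^ 2" where
  "G1_approximant \<phi> \<xi> \<eta> = bezier4 (control_point \<phi> \<xi> \<eta>)"

definition circular_arc :: "real \<Rightarrow> real ^ 2" where
  "circular_arc \<alpha> = vector [cos \<alpha>, sin \<alpha>]"

definition radial_error :: "real \<Rightarrow> real \<Rightarrow> real \<Rightarrow> real \<Rightarrow> real" where
  "radial_error \<phi> t \<xi> \<eta> = (norm (G1_approximant \<phi> \<xi> \<eta> t))\<^sup>2 - 1"

definition velocity :: "(real \<Rightarrow> real ^ 2) \<Rightarrow> real \<Rightarrow> real ^ 2" where
  "velocity f t = vector_derivative f (at t)"

definition signed_curvature :: "(real \<Rightarrow> real ^ 2) \<Rightarrow> real \<Rightarrow> real" where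
  "signed_curvature f t =
    (let v = velocity f t; a = velocity (velocity f) t
     in (v $ 1 * a $ 2 - v $ 2 * a $ 1) / norm v ^ 3)"

(* The parameter values -1 and 1 correspond to the arc angles -\<phi> and \<phi>. All curves are
   polynomial or trigonometric, hence defined and smooth on the whole line, so two-sided
   derivatives at the boundary parameters agree with the one-sided ones. *)
definition interpolates_curvature :: "real \<Rightarrow> real \<Rightarrow> real \<Rightarrow> bool" where
  "interpolates_curvature \<phi> \<xi> \<eta> \<longleftrightarrow>
    signed_curvature (G1_approximant \<phi> \<xi> \<eta>) (-1) = signed_curvature circular_arc (- \<phi>) \<and>
    signed_curvature (G1_approximant \<phi> \<xi> \<eta>) 1 = signed_curvature circular_arc \<phi>"

definition inner_G1 :: "real \<Rightarrow> real \<Rightarrow> real \<Rightarrow> bool" where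
  "inner_G1 \<phi> \<xi> \<eta> \<longleftrightarrow> \<xi> > 0 \<and> (\<forall>t\<in>{-1..1}. radial_error \<phi> t \<xi> \<eta> \<le> 0)"

definition inner_G2 :: "real \<Rightarrow> real \<Rightarrow> real \<Rightarrow> bool" where
  "inner_G2 \<phi> \<xi> \<eta> \<longleftrightarrow> inner_G1 \<phi> \<xi> \<eta> \<and> interpolates_curvature \<phi> \<xi> \<eta>"

(* The supremum is a maximum: radial_error is continuous in t and the interval is compact. *)
definition max_radial_error :: "real \<Rightarrow> real \<Rightarrow> real \<Rightarrow> real" where
  "max_radial_error \<phi> \<xi> \<eta> = (SUP t\<in>{-1..1}. \<bar>radial_error \<phi> t \<xi> \<eta>\<bar>)"

definition optimal_inner_G1 :: "real \<Rightarrow> real \<Rightarrow> real \<Rightarrow> bool" where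
  "optimal_inner_G1 \<phi> \<xi> \<eta> \<longleftrightarrow> inner_G1 \<phi> \<xi> \<eta> \<and>
    (\<forall>\<xi>' \<eta>'. inner_G1 \<phi> \<xi>' \<eta>' \<longrightarrow> max_radial_error \<phi> \<xi> \<eta> \<le> max_radial_error \<phi> \<xi>' \<eta>')"

definition optimal_inner_G2 :: "real \<Rightarrow> real \<Rightarrow> real \<Rightarrow> bool" where
  "optimal_inner_G2 \<phi> \<xi> \<eta> \<longleftrightarrow> inner_G2 \<phi> \<xi> \<eta> \<and>
    (\<forall>\<xi>' \<eta>'. inner_G2 \<phi> \<xi>' \<eta>' \<longrightarrow> max_radial_error \<phi> \<xi> \<eta> \<le> max_radial_error \<phi> \<xi>' \<eta>')"

end

theory Submission
  imports Defs
begin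

text \<open>
  With \<open>w = (1 - t\<^sup>2) / 4\<close> the radial error is \<open>w\<^sup>2\<close> times a convex quadratic polynomial in \<open>w\<close>, so
  an approximant is inner iff that quadratic is nonpositive at \<open>w = 0\<close>, i.e. \<open>4\<xi>\<^sup>2 + 3c\<eta> \<le> 3\<close>, and at
  \<open>w = 1/4\<close>, i.e. the midpoint \<open>(m, 0)\<close> of the curve satisfies \<open>\<bar>m\<bar> \<le> 1\<close>. The optimal parameters are
  those for which both constraints are active, with \<open>m = 1\<close>; there the error is a multiple of
  \<open>w\<^sup>3 (1/4 - w)\<close>, which is extremal at \<open>w = 3/16\<close>, i.e. at \<open>t = \<plusminus>1/2\<close>. Comparing the errors of all
  inner approximants at the single point \<open>t = 1/2\<close> already yields optimality and uniqueness. As the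
  first constraint being active is the \<open>G\<^sup>2\<close> condition, the \<open>G\<^sup>2\<close> optimum is the same.
\<close>

section \<open>Radial error and the inner condition\<close>

lemma G1_approximant_eq:
  defines "w \<equiv> \<lambda>t::real. (1 - t\<^sup>2) / 4"
  shows "G1_approximant \<phi> \<xi> \<eta> t = vector
    [cos \<phi> + 4 * \<xi> * sin \<phi> * w t + (6 * \<eta> - 6 * cos \<phi> - 8 * \<xi> * sin \<phi>) * (w t)\<^sup>2,
     t * (sin \<phi> + (2 * sin \<phi> - 4 * \<xi> * cos \<phi>) * w t)]"
proof -
  have "{..4::nat} = {0, 1, 2, 3, 4}" by auto
  then show ?thesis
    by (simp add: G1_approximant_def bezier4_def control_point_def w_def vec_eq_iff forall_2
        eval_nat_numeral binomial_eq_0)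
      (simp add: field_simps)
qed

text \<open>First coordinate of the curve at \<open>t = 0\<close>. It replaces \<eta> as a
  parameter: for fixed \<xi> the two determine each other linearly.\<close>

definition midpoint_abscissa :: "real \<Rightarrow> real \<Rightarrow> real \<Rightarrow> real" where
  "midpoint_abscissa \<phi> \<xi> \<eta> = (5 * cos \<phi> + 4 * \<xi> * sin \<phi> + 3 * \<eta>) / 8"

text \<open>The factor \<open>w\<^sup>2\<close> reflects the tangency to the circle at both ends. In
  the bracket, the first two terms interpolate linearly between its values at \<open>w = 0\<close>
  and \<open>w = 1/4\<close>; the last one is the convex deviation from that chord.\<close>

lemma radial_error_eq:
  fixes \<phi> \<xi> \<eta> t :: real
  defines "w \<equiv> (1 - t\<^sup>2) / 4" and "m \<equiv> midpoint_abscissa \<phi> \<xi> \<eta>"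
  shows "radial_error \<phi> t \<xi> \<eta> = w\<^sup>2 * (4 * (4 * \<xi>\<^sup>2 + 3 * cos \<phi> * \<eta> - 3) * (1 - 4 * w)
    - 64 * w * (1 - m\<^sup>2) - 256 * (m - cos \<phi> - \<xi> * sin \<phi>)\<^sup>2 * w * (1 / 4 - w))"
proof -
  define c s where "c = cos \<phi>" and "s = sin \<phi>"
  have s2: "s\<^sup>2 = 1 - c\<^sup>2" by (simp add: c_def s_def sin_squared_eq)
  have t2: "t\<^sup>2 = 1 - 4 * w" by (simp add: w_def field_simps)
  have "radial_error \<phi> t \<xi> \<eta> = (c + 4 * \<xi> * s * w + (6 * \<eta> - 6 * c - 8 * \<xi> * s) * w\<^sup>2)\<^sup>2
     + t\<^sup>2 * (s + (2 * s - 4 * \<xi> * c) * w)\<^sup>2 - 1"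
    unfolding radial_error_def G1_approximant_eq
    by (simp add: power2_norm_eq_inner inner_vec_def sum_2 w_def[symmetric] c_def s_def power_mult_distrib
        flip: power2_eq_square)
  also have "\<dots> = w\<^sup>2 * (4 * (4 * \<xi>\<^sup>2 + 3 * c * \<eta> - 3) * (1 - 4 * w)
    - 64 * w * (1 - m\<^sup>2) - 256 * (m - c - \<xi> * s)\<^sup>2 * w * (1 / 4 - w))"
    unfolding t2 m_def midpoint_abscissa_def c_def[symmetric] s_def[symmetric] using s2 by algebra
  finally show ?thesis by (simp add: c_def s_def)
qed

lemma inner_G1_iff:
  "inner_G1 \<phi> \<xi> \<eta> \<longleftrightarrow>
    \<xi> > 0 \<and> 4 * \<xi>\<^sup>2 + 3 * cos \<phi> * \<eta> \<le> 3 \<and> (midpoint_abscissa \<phi> \<xi> \<eta>)\<^sup>2 \<le> 1"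
proof -
  define A where "A = 4 * (4 * \<xi>\<^sup>2 + 3 * cos \<phi> * \<eta> - 3)"
  define m where "m = midpoint_abscissa \<phi> \<xi> \<eta>"
  define Q where "Q = m - cos \<phi> - \<xi> * sin \<phi>"
  define g where "g w = A * (1 - 4 * w) - 64 * w * (1 - m\<^sup>2) - 256 * Q\<^sup>2 * w * (1 / 4 - w)" for w
  have err: "radial_error \<phi> t \<xi> \<eta> = ((1 - t\<^sup>2) / 4)\<^sup>2 * g ((1 - t\<^sup>2) / 4)" for t
    unfolding radial_error_eq A_def m_def Q_def g_def ..
  have "(\<forall>t\<in>{-1..1}. radial_error \<phi> t \<xi> \<eta> \<le> 0) \<longleftrightarrow> A \<le> 0 \<and> m\<^sup>2 \<le> 1"
  proof (intro iffI conjI ballI)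
    assume *: "\<forall>t\<in>{-1..1}. radial_error \<phi> t \<xi> \<eta> \<le> 0"
    show "m\<^sup>2 \<le> 1" using bspec[OF *, of 0] by (simp add: err g_def power2_eq_square)
    show "A \<le> 0"
    proof (rule ccontr)
      assume "\<not> A \<le> 0"
      then have A: "A > 0" by simp
      \<comment> \<open>This choice gives \<open>g w \<ge> A - 4 * w * D\<close>, so
        \<open>w = A / (8 * D)\<close> leaves at least \<open>A / 2\<close>. The bound
        \<open>D \<ge> A\<close> keeps \<open>w \<le> 1 / 8\<close>, so that \<open>t\<close> lies
        in the interval.\<close>
      define D where "D = A + 16 + 16 * Q\<^sup>2"
      define w where "w = A / (8 * D)"
      define t where "t = sqrt (1 - 4 * w)"
      have D: "D \<ge> A" "D > 0" using A zero_le_power2[of Q] unfolding D_def by linarith+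
      have w: "w > 0" "w \<le> 1 / 8"
        using A D by (auto simp: w_def divide_simps)
      have t: "t \<in> {-1..1}" and wt: "(1 - t\<^sup>2) / 4 = w" using w by (auto simp: t_def intro: order_trans[of _ 0])
      have "w * D = A / 8" using D by (simp add: w_def)
      moreover have "g w = A - 4 * (w * D) + 64 * w * m\<^sup>2 + 256 * Q\<^sup>2 * w\<^sup>2"
        by (simp add: g_def D_def algebra_simps power2_eq_square)
      moreover have "64 * w * m\<^sup>2 \<ge> 0" "256 * Q\<^sup>2 * w\<^sup>2 \<ge> 0" using w by auto
      ultimately have "g w > 0" using A by linarith
      then have "radial_error \<phi> t \<xi> \<eta> > 0" using w by (simp add: err wt)
      then show False using * t by fastforce
    qed
  next
    fix t :: real assume A: "A \<le> 0 \<and> m\<^sup>2 \<le> 1" and "t \<in> {-1..1}"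
    define w where "w = (1 - t\<^sup>2) / 4"
    have "t\<^sup>2 \<le> 1" using \<open>t \<in> {-1..1}\<close> by (simp add: abs_square_le_1 abs_le_iff)
    then have w: "0 \<le> w" "w \<le> 1 / 4" by (auto simp: w_def)
    have "A * (1 - 4 * w) \<le> 0" using A w by (intro mult_nonpos_nonneg) auto
    moreover have "64 * w * (1 - m\<^sup>2) \<ge> 0" "256 * Q\<^sup>2 * w * (1 / 4 - w) \<ge> 0" using A w by auto
    ultimately have "g w \<le> 0" unfolding g_def by linarith
    then show "radial_error \<phi> t \<xi> \<eta> \<le> 0"
      by (simp add: err w_def[symmetric] mult_nonneg_nonpos)
  qed
  then show ?thesis by (auto simp: inner_G1_def A_def m_def)
qed

text \<open>Lets a single sample point bound the maximum from below; compactness supplies the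
  boundedness required for the supremum.\<close>

lemma abs_radial_error_le_max:
  assumes "t \<in> {-1..1}"
  shows "\<bar>radial_error \<phi> t \<xi> \<eta>\<bar> \<le> max_radial_error \<phi> \<xi> \<eta>"
  unfolding max_radial_error_def
proof (rule cSUP_upper[OF assms])
  have "continuous_on {-1..1} (\<lambda>t. \<bar>radial_error \<phi> t \<xi> \<eta>\<bar>)"
    unfolding radial_error_eq by (auto intro!: continuous_intros)
  then have "compact ((\<lambda>t. \<bar>radial_error \<phi> t \<xi> \<eta>\<bar>) ` {-1..1})"
    by (rule compact_continuous_image) simp
  then show "bdd_above ((\<lambda>t. \<bar>radial_error \<phi> t \<xi> \<eta>\<bar>) ` {-1..1})"
    by (intro bounded_imp_bdd_above compact_imp_bounded)
qed

section \<open>Curvature at the ends\<close>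

lemma has_vector_derivative_vector_2:
  fixes f g :: "real \<Rightarrow> real"
  assumes "(f has_real_derivative f') (at t)" and "(g has_real_derivative g') (at t)"
  shows "((\<lambda>t. vector [f t, g t] :: real ^ 2) has_vector_derivative vector [f', g']) (at t)"
proof -
  have eq: "(vector [a, b] :: real ^ 2) = a *\<^sub>R axis 1 1 + b *\<^sub>R axis 2 1" for a b
    by (simp add: vec_eq_iff forall_2 axis_def)
  show ?thesis unfolding eq using assms
    by (auto intro!: derivative_eq_intros simp: has_real_derivative_iff_has_vector_derivative)
qed

text \<open>The derivatives are assumed at every point, because the velocity is differentiated again
  as a function.\<close>

lemma signed_curvature_vector_2:
  assumes x: "\<And>t. (x has_real_derivative x' t) (at t)" "\<And>t. (x' has_real_derivative x'' t) (at t)"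
    and y: "\<And>t. (y has_real_derivative y' t) (at t)" "\<And>t. (y' has_real_derivative y'' t) (at t)"
  shows "signed_curvature (\<lambda>t. vector [x t, y t]) t
    = (x' t * y'' t - y' t * x'' t) / sqrt ((x' t)\<^sup>2 + (y' t)\<^sup>2) ^ 3"
proof -
  have v: "velocity (\<lambda>t. vector [x t, y t]) = (\<lambda>t. vector [x' t, y' t])"
    unfolding velocity_def
    by (intro ext vector_derivative_at has_vector_derivative_vector_2 x y)
  have a: "velocity (\<lambda>t. vector [x' t, y' t]) = (\<lambda>t. vector [x'' t, y'' t])"
    unfolding velocity_def
    by (intro ext vector_derivative_at has_vector_derivative_vector_2 x y)
  show ?thesis
    by (simp add: signed_curvature_def v a norm_vec_def L2_set_def sum_2)
qed

lemma signed_curvature_circular_arc: "signed_curvature circular_arc \<alpha> = 1"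
proof -
  have "signed_curvature (\<lambda>\<alpha>. vector [cos \<alpha>, sin \<alpha>]) \<alpha>
    = (- sin \<alpha> * - sin \<alpha> - cos \<alpha> * - cos \<alpha>) / sqrt ((- sin \<alpha>)\<^sup>2 + (cos \<alpha>)\<^sup>2) ^ 3"
    by (rule signed_curvature_vector_2) (auto intro!: derivative_eq_intros)
  then show ?thesis by (simp add: circular_arc_def[abs_def] flip: power2_eq_square)
qed

text \<open>At both ends \<open>w = 0\<close>, the speed is \<open>2 * \<xi>\<close>, and the
  remaining expressions involve \<open>t\<close> only through \<open>t\<^sup>2\<close>, so one
  computation serves both.\<close>

lemma signed_curvature_G1_approximant:
  assumes "\<xi> > 0" and "t\<^sup>2 = 1"
  shows "signed_curvature (G1_approximant \<phi> \<xi> \<eta>) t = 3 * (1 - cos \<phi> * \<eta>) / (4 * \<xi>\<^sup>2)"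
proof -
  define c s where "c = cos \<phi>" and "s = sin \<phi>"
  define q k where "q = 6 * \<eta> - 6 * c - 8 * \<xi> * s" and "k = 2 * s - 4 * \<xi> * c"
  define w where "w t = (1 - t\<^sup>2) / 4" for t :: real
  have sc: "s\<^sup>2 + c\<^sup>2 = 1" by (simp add: c_def s_def)
  have w': "(w has_real_derivative - t / 2) (at t)" for t
    unfolding w_def[abs_def] by (auto intro!: derivative_eq_intros)
  have G: "G1_approximant \<phi> \<xi> \<eta> = (\<lambda>t. vector [c + 4 * \<xi> * s * w t + q * (w t)\<^sup>2, t * (s + k * w t)])"
    by (simp add: fun_eq_iff G1_approximant_eq c_def s_def q_def k_def w_def)
  have "signed_curvature (G1_approximant \<phi> \<xi> \<eta>) t =
     (((4 * \<xi> * s + 2 * q * w t) * (- t / 2)) * (- 3 * k * t / 2)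
       - (s + k * w t - k * t\<^sup>2 / 2) * (q * t\<^sup>2 / 2 - (4 * \<xi> * s + 2 * q * w t) / 2))
     / sqrt (((4 * \<xi> * s + 2 * q * w t) * (- t / 2))\<^sup>2 + (s + k * w t - k * t\<^sup>2 / 2)\<^sup>2) ^ 3"
    unfolding G
    by (rule signed_curvature_vector_2)
      (auto intro!: derivative_eq_intros w' simp: algebra_simps power2_eq_square)
  moreover have "w t = 0" using assms by (simp add: w_def)
  moreover have "((4 * \<xi> * s) * (- t / 2))\<^sup>2 + (s - k * t\<^sup>2 / 2)\<^sup>2 = (2 * \<xi>)\<^sup>2"
    using assms(2) sc unfolding k_def by algebra
  moreover have "((4 * \<xi> * s) * (- t / 2)) * (- 3 * k * t / 2)
       - (s - k * t\<^sup>2 / 2) * (q * t\<^sup>2 / 2 - (4 * \<xi> * s) / 2) = 6 * \<xi> * (1 - c * \<eta>)"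
    using assms(2) sc unfolding k_def q_def by algebra
  ultimately have "signed_curvature (G1_approximant \<phi> \<xi> \<eta>) t = 6 * \<xi> * (1 - c * \<eta>) / (2 * \<xi>) ^ 3"
    using assms(1) by (simp add: real_sqrt_mult)
  also have "\<dots> = 3 * (1 - c * \<eta>) / (4 * \<xi>\<^sup>2)"
    using assms(1) by (simp add: field_simps power2_eq_square power3_eq_cube)
  finally show ?thesis by (simp add: c_def)
qed

lemma interpolates_curvature_iff:
  assumes "\<xi> > 0"
  shows "interpolates_curvature \<phi> \<xi> \<eta> \<longleftrightarrow> 4 * \<xi>\<^sup>2 + 3 * cos \<phi> * \<eta> = 3"
  using assms
  by (auto simp: interpolates_curvature_def signed_curvature_G1_approximant
      signed_curvature_circular_arc field_simps)

section \<open>The key inequality\<close>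

text \<open>
  Here \<open>y = \<xi> sin \<phi>\<close>. Since \<open>m - c - y\<close> may vanish, its square alone has no positive lower bound, but
  it can only drop by \<open>2 (1 - m) / (1 - c)\<close> below its optimal value \<open>Q0\<close>, and as \<open>Q0 < 1 - c\<close> this
  loss is outweighed by \<open>4 (1 - m\<^sup>2)\<close>.
\<close>
lemma midpoint_defect_less:
  fixes c R y0 y m :: real
  assumes c: "0 \<le> c" "c < 1" and R: "R \<ge> 0" "R\<^sup>2 = 3 + 4 * c + c\<^sup>2"
    and y0: "2 * y0 = c * (1 - c\<^sup>2) + (1 - c)\<^sup>2 * R"
    and y: "4 * y\<^sup>2 - 4 * c * (1 - c\<^sup>2) * y + (1 - c\<^sup>2) * (8 * c * m - 5 * c\<^sup>2 - 3) \<le> 0" "y \<ge> 0"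
    and m: "m\<^sup>2 \<le> 1" and ne: "y \<noteq> y0 \<or> m \<noteq> 1"
  shows "(1 - c - y0)\<^sup>2 < 4 * (1 - m\<^sup>2) + (m - c - y)\<^sup>2"
proof -
  define e where "e = 1 - c"
  define Q0 where "Q0 = 1 - c - y0"
  define Q where "Q = m - c - y"
  have e: "0 < e" "e \<le> 1" "c = 1 - e" using c by (auto simp: e_def)
  have R_ge: "R \<ge> 1 + c"
    by (rule power2_le_imp_le) (use R c in \<open>auto simp: power2_eq_square algebra_simps\<close>)
  \<comment> \<open>Conjugate form of \<open>2 * Q0 = e\<^sup>2 * (2 + c - R)\<close>, using
    \<open>(2 + c)\<^sup>2 - R\<^sup>2 = 1\<close>; it exhibits that \<open>Q0\<close> is positive
    and small.\<close>
  have Q0_eq: "2 * (2 + c + R) * Q0 = e\<^sup>2"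
    using y0 R(2) unfolding Q0_def e_def by algebra
  have Q0_pos: "Q0 > 0"
  proof (rule ccontr)
    assume "\<not> Q0 > 0"
    then have "2 * (2 + c + R) * Q0 \<le> 0" using c R by (intro mult_nonneg_nonpos) auto
    then show False using Q0_eq e by simp
  qed
  have "2 * Q0 \<le> 2 * (2 + c + R) * Q0" using Q0_pos c R by simp
  also have "\<dots> \<le> e" using Q0_eq e by (simp add: power2_eq_square mult_le_one)
  finally have Q0_le: "2 * Q0 \<le> e" .
  have m1: "-1 \<le> m" "m \<le> 1" using m by (auto simp: abs_square_le_1)
  \<comment> \<open>\<open>y0\<close> is the larger root of the constraint on \<open>y\<close> at
    \<open>m = 1\<close>. Subtracting the two quadratics bounds how far \<open>y\<close> can exceed
    it for smaller \<open>m\<close>.\<close>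
  have y0_root: "4 * y0\<^sup>2 - 4 * c * (1 - c\<^sup>2) * y0 + (1 - c\<^sup>2) * (8 * c - 5 * c\<^sup>2 - 3) = 0"
    using y0 R(2) by algebra
  have diff: "(y - y0) * (y + y0 - c * (1 - c\<^sup>2)) \<le> 2 * c * (1 - m) * (1 - c\<^sup>2)"
    using y(1) y0_root by (simp add: algebra_simps power2_eq_square)
  have step: "(y - y0) * e \<le> 2 * c * (1 - m)" if "y > y0"
  proof -
    \<comment> \<open>For \<open>y > y0\<close> the second factor in \<open>diff\<close> exceeds
      \<open>2 * y0 - c * (1 - c\<^sup>2) = e\<^sup>2 * R\<close>; afterwards
      \<open>e * (1 + c) = 1 - c\<^sup>2\<close> is cancelled.\<close>
    have "(y - y0) * (e\<^sup>2 * (1 + c)) \<le> (y - y0) * (e\<^sup>2 * R)"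
      using that R_ge by (intro mult_left_mono) auto
    also have "\<dots> \<le> (y - y0) * (y + y0 - c * (1 - c\<^sup>2))"
      using that y0 by (intro mult_left_mono) (auto simp: e_def)
    also have "\<dots> \<le> 2 * c * (1 - m) * (1 - c\<^sup>2)" by (rule diff)
    finally have "(e * (1 + c)) * ((y - y0) * e) \<le> (e * (1 + c)) * (2 * c * (1 - m))"
      by (simp add: e_def algebra_simps power2_eq_square)
    then show ?thesis using e by (subst (asm) mult_le_cancel_left_pos) auto
  qed
  consider "m \<le> 0" | "m = 1" | "0 < m" "m < 1" using m1 by linarith
  then have "Q0\<^sup>2 < 4 * (1 - m\<^sup>2) + Q\<^sup>2"
  proof cases
    case 1
    \<comment> \<open>Since \<open>c + y \<ge> 0\<close>, subtracting it from a nonpositive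
      \<open>m\<close> only increases the absolute value. The right-hand side is then at least
      \<open>4 - 3 * m\<^sup>2 \<ge> 1\<close>.\<close>
    have "m\<^sup>2 \<le> Q\<^sup>2"
      unfolding abs_le_square_iff[symmetric] Q_def using 1 c y(2) by auto
    moreover have "Q0\<^sup>2 < 1"
      using Q0_pos Q0_le e by (simp add: abs_square_less_1)
    ultimately show ?thesis using m by argo
  next
    case 2
    have "y \<le> y0"
    proof (rule ccontr)
      assume "\<not> y \<le> y0"
      then have "(y - y0) * e > 0" using e by simp
      then show False using step \<open>\<not> y \<le> y0\<close> 2 by simp
    qed
    then have "y < y0" using ne 2 by simp
    then have "Q0 < Q" using 2 by (simp add: Q_def Q0_def)
    then have "Q0\<^sup>2 < Q\<^sup>2" using Q0_pos by (intro power_strict_mono) auto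
    then show ?thesis using 2 by simp
  next
    case 3
    \<comment> \<open>\<open>Q0 - Q\<close> is \<open>(1 - m) + (y - y0)\<close>, and
      \<open>e + 2 * c = 1 + c \<le> 2\<close>.\<close>
    have drop: "(Q0 - Q) * e \<le> 2 * (1 - m)"
    proof -
      have "(y - y0) * e \<le> 2 * c * (1 - m)"
      proof (cases "y > y0")
        case False
        then have "(y - y0) * e \<le> 0" using e by (intro mult_nonpos_nonneg) auto
        also have "0 \<le> 2 * c * (1 - m)" using c 3 by simp
        finally show ?thesis .
      qed (rule step)
      moreover have "(e + 2 * c) * (1 - m) \<le> 2 * (1 - m)"
        using e 3 by (intro mult_right_mono) auto
      ultimately show ?thesis by (simp add: Q_def Q0_def algebra_simps)
    qed
    have "2 * Q0 * (Q0 - Q) \<le> 2 * (1 - m)"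
    proof (cases "Q0 \<ge> Q")
      case True
      then have "2 * Q0 * (Q0 - Q) \<le> e * (Q0 - Q)" using Q0_le by (intro mult_right_mono) auto
      then show ?thesis using drop by (simp add: mult.commute)
    next
      case False
      then have "2 * Q0 * (Q0 - Q) \<le> 0" using Q0_pos by (intro mult_nonneg_nonpos) auto
      then show ?thesis using 3 by simp
    qed
    moreover have "Q\<^sup>2 = Q0\<^sup>2 - 2 * Q0 * (Q0 - Q) + (Q0 - Q)\<^sup>2"
      by (simp add: power2_eq_square algebra_simps)
    moreover have "(Q0 - Q)\<^sup>2 \<ge> 0" by simp
    moreover have "1 - m\<^sup>2 > 1 - m" using 3 by (simp add: power2_eq_square)
    ultimately show ?thesis using 3 by argo
  qed
  then show ?thesis by (simp add: Q_def Q0_def)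
qed

section \<open>Optimality and uniqueness\<close>

theorem mainTheorem8:
  fixes \<phi> c \<xi>\<^sub>0 \<eta>\<^sub>0 :: real
  assumes "0 < \<phi>" and "\<phi> \<le> pi / 2"
    and "c = cos \<phi>"
    and "\<xi>\<^sub>0 = (c * (1 - c\<^sup>2) + (1 - c)\<^sup>2 * sqrt (3 + 4 * c + c\<^sup>2)) / (2 * sqrt (1 - c\<^sup>2))"
    and "\<eta>\<^sub>0 = 1 / 3 * (8 - 7 * c + 2 * c ^ 3 - 2 * (1 - c)\<^sup>2 * sqrt (3 + 4 * c + c\<^sup>2))"
  shows "(\<forall>\<xi> \<eta>. optimal_inner_G1 \<phi> \<xi> \<eta> \<longleftrightarrow> \<xi> = \<xi>\<^sub>0 \<and> \<eta> = \<eta>\<^sub>0) \<and>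
         (\<forall>\<xi> \<eta>. optimal_inner_G2 \<phi> \<xi> \<eta> \<longleftrightarrow> \<xi> = \<xi>\<^sub>0 \<and> \<eta> = \<eta>\<^sub>0)"
proof -
  define s where "s = sin \<phi>"
  define R where "R = sqrt (3 + 4 * c + c\<^sup>2)"
  have c: "0 \<le> c" "c < 1"
    using assms(1,2) cos_monotone_0_pi[of 0 \<phi>] by (auto simp: assms(3) intro: cos_ge_zero)
  have s: "s > 0" using assms(1,2) pi_gt_zero by (auto simp: s_def intro!: sin_gt_zero)
  have s2: "s\<^sup>2 = 1 - c\<^sup>2" by (simp add: s_def assms(3) sin_squared_eq)
  have R: "R > 0" "R\<^sup>2 = 3 + 4 * c + c\<^sup>2" using c by (auto simp: R_def intro!: add_pos_nonneg)
  have "sqrt (1 - c\<^sup>2) = s" using s by (simp flip: s2)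
  then have y0: "2 * (\<xi>\<^sub>0 * s) = c * (1 - c\<^sup>2) + (1 - c)\<^sup>2 * R"
    using s by (simp add: assms(4) R_def)
  have \<eta>\<^sub>0: "3 * \<eta>\<^sub>0 = 8 - 5 * c - 4 * \<xi>\<^sub>0 * s"
    using y0 by (simp add: assms(5) R_def algebra_simps power2_eq_square power3_eq_cube)
  have "2 * (\<xi>\<^sub>0 * s) > 0" unfolding y0 using c R s2 s
    by (intro add_nonneg_pos mult_nonneg_nonneg mult_pos_pos) (auto simp flip: s2)
  then have \<xi>\<^sub>0_pos: "\<xi>\<^sub>0 > 0" using s by (simp add: zero_less_mult_iff)
  \<comment> \<open>The factor \<open>s\<^sup>2\<close> turns \<xi> into the product
    \<open>\<xi>\<^sub>0 * s\<close>, for which \<open>y0\<close> is free of denominators.\<close>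
  have "s\<^sup>2 * (4 * \<xi>\<^sub>0\<^sup>2 + 3 * c * \<eta>\<^sub>0 - 3) = 0"
    using y0 \<eta>\<^sub>0 R(2) s2 by algebra
  then have G2_0: "4 * \<xi>\<^sub>0\<^sup>2 + 3 * c * \<eta>\<^sub>0 = 3" using s by simp
  have m_0: "midpoint_abscissa \<phi> \<xi>\<^sub>0 \<eta>\<^sub>0 = 1"
    using \<eta>\<^sub>0 by (simp add: midpoint_abscissa_def s_def assms(3))
  have inner_0: "inner_G1 \<phi> \<xi>\<^sub>0 \<eta>\<^sub>0"
    using \<xi>\<^sub>0_pos G2_0 m_0 by (simp add: inner_G1_iff assms(3))
  then have inner2_0: "inner_G2 \<phi> \<xi>\<^sub>0 \<eta>\<^sub>0"
    using \<xi>\<^sub>0_pos G2_0 by (simp add: inner_G2_def interpolates_curvature_iff assms(3))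
  \<comment> \<open>The coefficient is \<open>256 * (3/16)^3 * (1/16)\<close>, from the value of
    \<open>256 * w^3 * (1/4 - w)\<close> at its maximum \<open>w = 3/16\<close>.\<close>
  define E where "E = 27 / 256 * (1 - c - \<xi>\<^sub>0 * s)\<^sup>2"
  have max_0: "max_radial_error \<phi> \<xi>\<^sub>0 \<eta>\<^sub>0 \<le> E"
    unfolding max_radial_error_def
  proof (rule cSUP_least)
    fix t :: real assume "t \<in> {-1..1}"
    define w where "w = (1 - t\<^sup>2) / 4"
    have "t\<^sup>2 \<le> 1" using \<open>t \<in> {-1..1}\<close> by (simp add: abs_square_le_1 abs_le_iff)
    then have w: "0 \<le> w" "w \<le> 1 / 4" by (auto simp: w_def)
    \<comment> \<open>The maximum at \<open>w = 3/16\<close> is a double zero of the difference,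
      which leaves a positive quadratic cofactor.\<close>
    have "27 / 65536 - w ^ 3 * (1 / 4 - w) = (w - 3 / 16)\<^sup>2 * ((w + 1 / 16)\<^sup>2 + 1 / 128)"
      by (simp add: algebra_simps power2_eq_square power3_eq_cube)
    also have "\<dots> \<ge> 0" by simp
    finally have amgm: "w ^ 3 * (1 / 4 - w) \<le> 27 / 65536" by simp
    have "radial_error \<phi> t \<xi>\<^sub>0 \<eta>\<^sub>0 = - (256 * (1 - c - \<xi>\<^sub>0 * s)\<^sup>2 * (w ^ 3 * (1 / 4 - w)))"
      using G2_0 unfolding radial_error_eq m_0 w_def[symmetric] s_def[symmetric] assms(3)[symmetric]
      by (simp add: power2_eq_square power3_eq_cube)
    then have "\<bar>radial_error \<phi> t \<xi>\<^sub>0 \<eta>\<^sub>0\<bar> = 256 * (1 - c - \<xi>\<^sub>0 * s)\<^sup>2 * (w ^ 3 * (1 / 4 - w))"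
      using w by simp
    also have "\<dots> \<le> 256 * (1 - c - \<xi>\<^sub>0 * s)\<^sup>2 * (27 / 65536)"
      by (intro mult_left_mono amgm) auto
    finally show "\<bar>radial_error \<phi> t \<xi>\<^sub>0 \<eta>\<^sub>0\<bar> \<le> E" by (simp add: E_def)
  qed simp
  \<comment> \<open>Strictness here gives uniqueness as well as optimality, and \<open>max_0\<close>
    is needed only as an upper bound.\<close>
  have max_gt: "E < max_radial_error \<phi> \<xi> \<eta>"
    if inner: "inner_G1 \<phi> \<xi> \<eta>" and ne: "\<not> (\<xi> = \<xi>\<^sub>0 \<and> \<eta> = \<eta>\<^sub>0)" for \<xi> \<eta>
  proof -
    define m where "m = midpoint_abscissa \<phi> \<xi> \<eta>"
    define A where "A = 4 * \<xi>\<^sup>2 + 3 * c * \<eta> - 3"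
    have \<xi>: "\<xi> > 0" and A: "A \<le> 0" and m: "m\<^sup>2 \<le> 1"
      using inner by (auto simp: inner_G1_iff m_def A_def assms(3))
    have \<eta>: "3 * \<eta> = 8 * m - 5 * c - 4 * \<xi> * s"
      by (simp add: m_def midpoint_abscissa_def s_def assms(3) field_simps)
    \<comment> \<open>The end condition \<open>A \<le> 0\<close>, scaled by \<open>s\<^sup>2\<close>
      and with \<eta> eliminated in favour of \<open>m\<close>.\<close>
    have "4 * (\<xi> * s)\<^sup>2 - 4 * c * (1 - c\<^sup>2) * (\<xi> * s) + (1 - c\<^sup>2) * (8 * c * m - 5 * c\<^sup>2 - 3) = s\<^sup>2 * A"
      using \<eta> s2 unfolding A_def by algebra
    also have "\<dots> \<le> 0" using A by (simp add: mult_nonneg_nonpos)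
    finally have y: "4 * (\<xi> * s)\<^sup>2 - 4 * c * (1 - c\<^sup>2) * (\<xi> * s) + (1 - c\<^sup>2) * (8 * c * m - 5 * c\<^sup>2 - 3) \<le> 0" .
    have "\<xi> * s \<noteq> \<xi>\<^sub>0 * s \<or> m \<noteq> 1"
      using ne s \<eta> \<eta>\<^sub>0 by auto
    then have less: "(1 - c - \<xi>\<^sub>0 * s)\<^sup>2 < 4 * (1 - m\<^sup>2) + (m - c - \<xi> * s)\<^sup>2"
      using c R y0 y \<xi> s m by (intro midpoint_defect_less[where R = R]) auto
    \<comment> \<open>At \<open>t = 1/2\<close> one has \<open>w = 3/16\<close>; since
      \<open>A \<le> 0\<close>, its term can only enlarge the error.\<close>
    have "- radial_error \<phi> (1 / 2) \<xi> \<eta>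
      = 27 / 256 * (4 * (1 - m\<^sup>2) + (m - c - \<xi> * s)\<^sup>2) - 9 / 256 * A"
      unfolding radial_error_eq m_def[symmetric] s_def[symmetric] assms(3)[symmetric] A_def
      by algebra
    then have "E < - radial_error \<phi> (1 / 2) \<xi> \<eta>" using less A unfolding E_def by argo
    also have "\<dots> \<le> max_radial_error \<phi> \<xi> \<eta>"
      using abs_radial_error_le_max[of "1 / 2" \<phi> \<xi> \<eta>] by simp
    finally show ?thesis .
  qed
  have opt: "max_radial_error \<phi> \<xi>\<^sub>0 \<eta>\<^sub>0 \<le> max_radial_error \<phi> \<xi> \<eta>" if "inner_G1 \<phi> \<xi> \<eta>" for \<xi> \<eta>
    using max_0 max_gt[OF that] by fastforce
  have unique: "\<xi> = \<xi>\<^sub>0 \<and> \<eta> = \<eta>\<^sub>0"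
    if "inner_G1 \<phi> \<xi> \<eta>" "max_radial_error \<phi> \<xi> \<eta> \<le> max_radial_error \<phi> \<xi>\<^sub>0 \<eta>\<^sub>0" for \<xi> \<eta>
    using max_0 max_gt[OF that(1)] that(2) by fastforce
  show ?thesis
    using inner_0 inner2_0 opt unique
    unfolding optimal_inner_G1_def optimal_inner_G2_def inner_G2_def by blast
qed

end
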